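(* Let $X$ be a Banach space over $\mathbb{K}\in\{\mathbb{R},\mathbb{C}\}$ and $T\in B(X)$. (i) If $T$ is a $(1,\infty)$-isometry, then $T$ is an isometry. (ii) If $T$ is an isometry, then $T$ is an $(m,\infty)$-isometry for all $m\in\mathbb{N}$, $m\ge1$. (iii) If $T$ is an $(m,\infty)$-isometry for some $m\in\mathbb{N}$, $m\ge 1$, then $T$ is bounded below (hence injective) and therefore has closed range. (iv) If $T$ is a $(2,\infty)$-isometry, then $\|Tx\|\ge\|x\|$ for all $x\in X$.
   Context: $B(X)$ is the algebra of bounded linear operators on $X$. For $m\in\mathbb{N}$, $m\ge1$, an operator $T\in B(X)$ is an $(m,\infty)$-isometry if for all $x\in X$ $$\max_{\substack{k=0,\dots,m\\ k\text{ even}}}\|T^kx\|=\max_{\substack{k=0,\dots,m\\ k\text{ odd}}}\|T^kx\|.$$ An isometry is an operator $T$ with $\|Tx\|=\|x\|$ for all $x\in X$. $T$ is bounded below if there is $c>0$ with $\|Tx\|\ge c\|x\|$ for all $x\in X$. *)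

theory Defs
  imports "HOL-Analysis.Analysis"
begin

text \<open>
  The scalar field is the real or the complex numbers: the field either consists of the
  embedded reals only, or is obtained from them by adjoining a square root of \<open>-1\<close>.
  The multiplicativity of the norm then forces it to be the usual absolute value.
\<close>

class real_or_complex = real_normed_field +
  assumes real_or_complex:
    "(\<forall>z. \<exists>a. z = a *\<^sub>R 1) \<or>
     (\<exists>i. i * i = - 1 \<and> (\<forall>z. \<exists>a b. z = a *\<^sub>R 1 + b *\<^sub>R i))"

instance real :: real_or_complex
  by standard simp

instance complex :: real_or_complex
proof
  have "\<i> * \<i> = - 1 \<and> (\<forall>z. \<exists>a b. z = a *\<^sub>R 1 + b *\<^sub>R \<i>)"
  proof (intro conjI allI)
    fix z
    have "z = Re z *\<^sub>R 1 + Im z *\<^sub>R \<i>"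
      by (simp add: complex_eq_iff)
    then show "\<exists>a b. z = a *\<^sub>R 1 + b *\<^sub>R \<i>"
      by blast
  qed simp
  then show "(\<forall>z::complex. \<exists>a. z = a *\<^sub>R 1) \<or>
      (\<exists>i::complex. i * i = - 1 \<and> (\<forall>z. \<exists>a b. z = a *\<^sub>R 1 + b *\<^sub>R i))"
    by blast
qed

text \<open>
  The class \<^class>\<open>banach\<close> supplies completeness, but only a real scalar multiplication. The
  multiplication by the scalar field is an explicit operation extending the real one.
\<close>

locale banach_space_over = vector_space smul
  for smul :: "'k::real_or_complex \<Rightarrow> 'a::banach \<Rightarrow> 'a" +
  assumes smul_of_real: "smul (of_real r) x = r *\<^sub>R x"
    and norm_smul: "norm (smul c x) = norm c * norm x"

lemma banach_space_over_scaleR: "banach_space_over (scaleR :: real \<Rightarrow> 'a::banach \<Rightarrow> 'a)"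
  by unfold_locales (auto simp: algebra_simps)

lemma banach_space_over_complex: "banach_space_over ((*) :: complex \<Rightarrow> complex \<Rightarrow> complex)"
  by unfold_locales (auto simp: algebra_simps scaleR_conv_of_real norm_mult)

definition bounded_operators ::
    "('k::real_or_complex \<Rightarrow> 'a::banach \<Rightarrow> 'a) \<Rightarrow> ('a \<Rightarrow> 'a) set" where
  "bounded_operators smul =
     {T. Vector_Spaces.linear smul smul T \<and> (\<exists>C. \<forall>x. norm (T x) \<le> C * norm x)}"

text \<open>Meaningful only for \<open>m \<ge> 1\<close>: for \<open>m = 0\<close> the right-hand maximum is over the empty set.\<close>

definition m_infinity_isometry :: "nat \<Rightarrow> ('a::real_normed_vector \<Rightarrow> 'a) \<Rightarrow> bool" where
  "m_infinity_isometry m T \<longleftrightarrow>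
     (\<forall>x. Max ((\<lambda>k. norm ((T ^^ k) x)) ` {k \<in> {0..m}. even k}) =
          Max ((\<lambda>k. norm ((T ^^ k) x)) ` {k \<in> {0..m}. odd k}))"

definition isometry_op :: "('a::real_normed_vector \<Rightarrow> 'a) \<Rightarrow> bool" where
  "isometry_op T \<longleftrightarrow> (\<forall>x. norm (T x) = norm x)"

definition bounded_below :: "('a::real_normed_vector \<Rightarrow> 'a) \<Rightarrow> bool" where
  "bounded_below T \<longleftrightarrow> (\<exists>c>0. \<forall>x. norm (T x) \<ge> c * norm x)"

end

theory Submission
  imports Defs
begin

text \<open>
  Everything rests on comparing the term \<open>k = 0\<close> of the even maximum, which is the norm of \<open>x\<close>,
  with the odd maximum. If the latter is attained at \<open>k\<close>, then \<open>k \<ge> 1\<close>, so \<open>T\<^sup>k x\<close> is the image of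
  \<open>T x\<close> under the bounded operator \<open>T\<^sup>k\<^sup>-\<^sup>1\<close>; hence the norm of \<open>x\<close> is at most a constant times the
  norm of \<open>T x\<close>. A bounded linear map between complete spaces that is bounded below maps
  the whole space onto a complete, hence closed, subspace. If \<open>T\<close> is an isometry, then
  all terms of both maxima equal the norm of \<open>x\<close>. For \<open>m = 1\<close> each maximum has a single term, and for \<open>m = 2\<close> the odd maximum is the norm of \<open>T x\<close>, which
  gives the constant \<open>1\<close>.
\<close>

text \<open>
  The scalar multiplication restricts to the real one on the embedded reals, so an operator that
  is linear over the scalar field is in particular linear over the reals.
\<close>

lemma bounded_operators_bounded_linear:
  assumes "banach_space_over smul" and "T \<in> bounded_operators smul"
  shows "bounded_linear T"
proof -
  have lin: "Vector_Spaces.linear smul smul T"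
    using assms(2) by (simp add: bounded_operators_def)
  obtain C where C: "\<And>x. norm (T x) \<le> C * norm x"
    using assms(2) by (auto simp: bounded_operators_def)
  show ?thesis
  proof (rule bounded_linear_intro)
    show "T (x + y) = T x + T y" for x y
      using lin by (rule Vector_Spaces.linear.axioms(3)[THEN module_hom.add])
    have "T (smul (of_real r) x) = smul (of_real r) (T x)" for r x
      using lin by (rule Vector_Spaces.linear.axioms(3)[THEN module_hom.scale])
    then show "T (r *\<^sub>R x) = r *\<^sub>R T x" for r x
      by (simp add: banach_space_over.smul_of_real[OF assms(1)])
    show "norm (T x) \<le> norm x * C" for x
      using C[of x] by (simp add: mult.commute)
  qed
qed

lemma norm_funpow_le:
  fixes T :: "'a::real_normed_vector \<Rightarrow> 'a"
  assumes "\<And>x. norm (T x) \<le> C * norm x" and "0 \<le> C"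
  shows "norm ((T ^^ n) x) \<le> C ^ n * norm x"
proof (induction n)
  case (Suc n)
  have "norm ((T ^^ Suc n) x) \<le> C * norm ((T ^^ n) x)"
    using assms(1) by simp
  also have "\<dots> \<le> C * (C ^ n * norm x)"
    using Suc assms(2) by (rule mult_left_mono)
  finally show ?case
    by (simp add: mult.assoc)
qed simp

lemma isometry_op_funpow:
  assumes "isometry_op T"
  shows "norm ((T ^^ n) x) = norm x"
  using assms by (induction n) (simp_all add: isometry_op_def)

lemma m_infinity_isometry_1_imp_isometry_op:
  assumes "m_infinity_isometry 1 T"
  shows "isometry_op T"
proof -
  have "{k \<in> {0..1::nat}. even k} = {0}" and "{k \<in> {0..1::nat}. odd k} = {1}"
    by (auto elim: oddE simp: le_Suc_eq)
  then show ?thesis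
    using assms by (simp add: m_infinity_isometry_def isometry_op_def)
qed

lemma isometry_op_imp_m_infinity_isometry:
  assumes "isometry_op T" and "m \<ge> 1"
  shows "m_infinity_isometry m T"
proof -
  have "0 \<in> {k \<in> {0..m}. even k}" and "1 \<in> {k \<in> {0..m}. odd k}"
    using assms(2) by auto
  then have "{k \<in> {0..m}. even k} \<noteq> {}" and "{k \<in> {0..m}. odd k} \<noteq> {}"
    by blast+
  then show ?thesis
    unfolding m_infinity_isometry_def isometry_op_funpow[OF assms(1)]
    by (simp only: image_constant_conv if_False Max_singleton simp_thms)
qed

text \<open>
  A maximum over a finite nonempty set is attained, and the even maximum dominates its term
  at \<open>0\<close>. The hypothesis \<open>m \<ge> 1\<close> makes the set of odd indices nonempty.
\<close>

lemma m_infinity_isometry_norm_le_odd_power: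
  assumes "m_infinity_isometry m T" and "m \<ge> 1"
  obtains k where "odd k" and "k \<le> m" and "norm x \<le> norm ((T ^^ k) x)"
proof -
  let ?f = "\<lambda>k. norm ((T ^^ k) x)"
  have "?f 0 \<le> Max (?f ` {k \<in> {0..m}. even k})"
    by (intro Max_ge imageI) auto
  also have "\<dots> = Max (?f ` {k \<in> {0..m}. odd k})"
    using assms(1) by (simp add: m_infinity_isometry_def)
  finally have "?f 0 \<le> Max (?f ` {k \<in> {0..m}. odd k})" .
  moreover have "1 \<in> {k \<in> {0..m}. odd k}"
    using assms(2) by simp
  then have "Max (?f ` {k \<in> {0..m}. odd k}) \<in> ?f ` {k \<in> {0..m}. odd k}"
    by (intro Max_in finite_imageI) (simp, blast)
  ultimately show ?thesis
    using that by auto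
qed

lemma m_infinity_isometry_imp_bounded_below:
  assumes "bounded_linear T" and "m_infinity_isometry m T" and "m \<ge> 1"
  shows "bounded_below T"
proof -
  obtain C0 where C0: "\<And>x. norm (T x) \<le> norm x * C0"
    using bounded_linear.bounded[OF assms(1)] by blast
  \<comment> \<open>A bound of at least \<open>1\<close> makes its powers increase with the exponent, so that one constant
    serves for every \<open>x\<close>, although the exponent at which the odd maximum is attained varies.\<close>
  define C where "C = max 1 C0"
  have C1: "1 \<le> C"
    by (simp add: C_def)
  have C: "norm (T x) \<le> C * norm x" for x
    using C0[of x] mult_left_mono[of C0 C "norm x"] by (simp add: C_def mult.commute)
  have "norm x \<le> C ^ m * norm (T x)" for x
  proof -
    obtain k where k: "odd k" "k \<le> m" "norm x \<le> norm ((T ^^ k) x)"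
      using m_infinity_isometry_norm_le_odd_power[OF assms(2,3)] by blast
    obtain j where j: "k = Suc j"
      using k(1) by (cases k) auto
    have "norm x \<le> norm ((T ^^ j) (T x))"
      using k(3) by (simp add: j funpow_swap1)
    also have "\<dots> \<le> C ^ j * norm (T x)"
      using C C1 by (intro norm_funpow_le) auto
    also have "\<dots> \<le> C ^ m * norm (T x)"
      using C1 k(2) j by (intro mult_right_mono power_increasing) auto
    finally show ?thesis .
  qed
  then have "inverse (C ^ m) * norm x \<le> norm (T x)" for x
    using C1 by (simp add: field_simps)
  moreover have "inverse (C ^ m) > 0"
    using C1 by simp
  ultimately show ?thesis
    unfolding bounded_below_def by blast
qed

lemma bounded_below_imp_inj:
  assumes "linear T" and "bounded_below T"
  shows "inj T"
proof -
  obtain c where "c > 0" and c: "\<And>x. c * norm x \<le> norm (T x)"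
    using assms(2) by (auto simp: bounded_below_def)
  have "x = 0" if "T x = 0" for x
    using c[of x] \<open>c > 0\<close> that by (simp add: mult_le_0_iff)
  then show ?thesis
    using assms(1) by (simp add: linear_injective_0)
qed

lemma bounded_below_imp_closed_range:
  fixes T :: "'a::banach \<Rightarrow> 'a"
  assumes "bounded_linear T" and "bounded_below T"
  shows "closed (range T)"
proof -
  obtain c where "c > 0" and c: "\<And>x. c * norm x \<le> norm (T x)"
    using assms(2) by (auto simp: bounded_below_def)
  have "complete (range T)"
    by (rule complete_isometric_image[OF \<open>c > 0\<close> subspace_UNIV assms(1)])
      (use c in \<open>auto simp: complete_UNIV\<close>)
  then show ?thesis
    by (rule complete_imp_closed)
qed

lemma m_infinity_isometry_2_imp_norm_le:
  assumes "m_infinity_isometry 2 T"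
  shows "norm x \<le> norm (T x)"
proof -
  obtain k where k: "odd k" "k \<le> 2" "norm x \<le> norm ((T ^^ k) x)"
    using m_infinity_isometry_norm_le_odd_power[OF assms] by auto
  then have "k = 1"
    by (auto simp: numeral_2_eq_2 le_Suc_eq)
  with k(3) show ?thesis
    by simp
qed

theorem proposition6p2:
  fixes smul :: "'k::real_or_complex \<Rightarrow> 'a::banach \<Rightarrow> 'a"
    and T :: "'a \<Rightarrow> 'a"
  assumes "banach_space_over smul"
    and "T \<in> bounded_operators smul"
  shows "(m_infinity_isometry 1 T \<longrightarrow> isometry_op T) \<and>
    (isometry_op T \<longrightarrow> (\<forall>m\<ge>1. m_infinity_isometry m T)) \<and>
    ((\<exists>m\<ge>1. m_infinity_isometry m T) \<longrightarrow>
      bounded_below T \<and> inj T \<and> closed (range T)) \<and>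
    (m_infinity_isometry 2 T \<longrightarrow> (\<forall>x. norm (T x) \<ge> norm x))"
proof -
  have T: "bounded_linear T"
    using assms by (rule bounded_operators_bounded_linear)
  have below: "bounded_below T" if "\<exists>m\<ge>1. m_infinity_isometry m T"
    using that m_infinity_isometry_imp_bounded_below[OF T] by blast
  show ?thesis
    using m_infinity_isometry_1_imp_isometry_op[of T] isometry_op_imp_m_infinity_isometry[of T]
      below bounded_below_imp_inj[OF bounded_linear.linear[OF T]]
      bounded_below_imp_closed_range[OF T] m_infinity_isometry_2_imp_norm_le[of T]
    by blast
qed

end
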